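(* For every integer $n\geq 2$, $\chi'_{\rm CF}(K_n)\leq \lceil\log_2(n-1)\rceil+1$, where $K_n$ is the complete graph on $n$ vertices.
   Context: For a finite simple graph $G=(V,E)$ without isolated vertices, an edge coloring $c$ of $G$ is any assignment of colors to the edges of $G$ (not necessarily proper). For a vertex $v$, $E_G(v)$ denotes the set of edges of $G$ incident with $v$. For an edge $uv\in E$, its closed neighborhood is $E_G[uv]=E_G(u)\cup E_G(v)$ (so it contains $uv$ itself). An edge $uv$ is satisfied by $c$ if some color appears exactly once on the edges of $E_G[uv]$. The coloring $c$ of $E$ is conflict-free if every edge of $G$ is satisfied. The conflict-free chromatic index $\chi'_{\rm CF}(G)$ is the least number of colors in a conflict-free edge coloring of $G$. *)

theory Defs
  imports Complex_Main
begin

type_synonym 'a ugraph = "'a set \<times> 'a set set"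

abbreviation verts :: "'a ugraph \<Rightarrow> 'a set" where
  "verts G \<equiv> fst G"

abbreviation edges :: "'a ugraph \<Rightarrow> 'a set set" where
  "edges G \<equiv> snd G"

definition finite_simple_graph :: "'a ugraph \<Rightarrow> bool" where
  "finite_simple_graph G \<longleftrightarrow>
     finite (verts G) \<and> (\<forall>e\<in>edges G. e \<subseteq> verts G \<and> card e = 2)"

definition incident_edges :: "'a ugraph \<Rightarrow> 'a \<Rightarrow> 'a set set" where
  "incident_edges G v = {e \<in> edges G. v \<in> e}"

definition no_isolated_vertices :: "'a ugraph \<Rightarrow> bool" where
  "no_isolated_vertices G \<longleftrightarrow> (\<forall>v\<in>verts G. incident_edges G v \<noteq> {})"

definition closed_edge_nbhd :: "'a ugraph \<Rightarrow> 'a set \<Rightarrow> 'a set set" where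
  "closed_edge_nbhd G e = (\<Union>v\<in>e. incident_edges G v)"

definition edge_satisfied :: "'a ugraph \<Rightarrow> ('a set \<Rightarrow> 'c) \<Rightarrow> 'a set \<Rightarrow> bool" where
  "edge_satisfied G c e \<longleftrightarrow> (\<exists>k. \<exists>!f. f \<in> closed_edge_nbhd G e \<and> c f = k)"

definition conflict_free :: "'a ugraph \<Rightarrow> ('a set \<Rightarrow> 'c) \<Rightarrow> bool" where
  "conflict_free G c \<longleftrightarrow> (\<forall>e\<in>edges G. edge_satisfied G c e)"

text \<open>Colors are natural numbers, which is no restriction for a finite graph; a coloring is
  constrained only on the edges, and only colors occurring there are counted.\<close>

definition cf_chromatic_index :: "'a ugraph \<Rightarrow> nat" where
  "cf_chromatic_index G =
     (LEAST k. \<exists>c :: 'a set \<Rightarrow> nat. conflict_free G c \<and> card (c ` edges G) = k)"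

definition complete_graph :: "nat \<Rightarrow> nat ugraph" where
  "complete_graph n = ({..<n}, {e. e \<subseteq> {..<n} \<and> card e = 2})"

lemma finite_simple_graph_complete: "finite_simple_graph (complete_graph n)"
  by (simp add: finite_simple_graph_def complete_graph_def)

lemma no_isolated_vertices_complete:
  assumes "n \<ge> 2"
  shows "no_isolated_vertices (complete_graph n)"
  unfolding no_isolated_vertices_def
proof
  fix v assume "v \<in> verts (complete_graph n)"
  then have v: "v < n" by (simp add: complete_graph_def)
  define w where "w = (if v = 0 then 1 else 0 :: nat)"
  have "w < n" "w \<noteq> v" using assms by (auto simp: w_def)
  then have "{v, w} \<in> incident_edges (complete_graph n) v"
    using v by (auto simp: incident_edges_def complete_graph_def)
  then show "incident_edges (complete_graph n) v \<noteq> {}" by blast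
qed

lemma closed_edge_nbhd_pair:
  "closed_edge_nbhd G {u, v} = incident_edges G u \<union> incident_edges G v"
  by (simp add: closed_edge_nbhd_def)

text \<open>An injective coloring is conflict-free, so the minimum defining the index is attained.\<close>

lemma ex_conflict_free:
  assumes "finite_simple_graph G"
  shows "\<exists>c :: 'a set \<Rightarrow> nat. conflict_free (G :: 'a ugraph) c"
proof -
  have "edges G \<subseteq> Pow (verts G)" "finite (verts G)"
    using assms by (auto simp: finite_simple_graph_def)
  then have "finite (edges G)" by (meson finite_Pow_iff finite_subset)
  then obtain c :: "'a set \<Rightarrow> nat" where inj: "inj_on c (edges G)"
    using finite_imp_inj_to_nat_seg by blast
  have "edge_satisfied G c e" if e: "e \<in> edges G" for e
  proof -
    have "e \<noteq> {}" using e assms by (auto simp: finite_simple_graph_def)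
    then have "e \<in> closed_edge_nbhd G e"
      using e by (auto simp: closed_edge_nbhd_def incident_edges_def)
    moreover have "f = e" if "f \<in> closed_edge_nbhd G e" "c f = c e" for f
      using that e inj by (auto simp: closed_edge_nbhd_def incident_edges_def inj_on_def)
    ultimately show ?thesis unfolding edge_satisfied_def by blast
  qed
  then show ?thesis by (auto simp: conflict_free_def)
qed

end

theory Submission
  imports Defs
begin

text \<open>
  Fix a color \<open>i\<close> whose color class is a matching. An edge \<open>xy\<close> sees \<open>i\<close> exactly once iff \<open>xy\<close>
  itself belongs to the matching, or exactly one of \<open>x\<close>, \<open>y\<close> is matched. So it suffices to find,
  on \<open>n \<ge> 3\<close> vertices, \<open>k = \<lceil>log\<^sub>2(n - 1)\<rceil>\<close> pairwise edge-disjoint matchings such that each two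
  vertices are matched with each other by one of them, or are told apart by one of them in this
  sense; all remaining edges receive one further color, which never has to satisfy anything.

  That \<open>2\<^sup>k + 1\<close> vertices can be reached with \<open>k\<close> matchings follows by induction
  (\<open>separating_matchings_exist\<close>) from \<open>k = 1\<close>, where one edge among three vertices will do. For
  the step to \<open>k + 1\<close>, split the vertices into \<open>A\<close>, of size \<open>2\<^sup>k\<close>, and \<open>B\<close>, of size at
  most \<open>2\<^sup>k + 1\<close>, and let the new matching be a perfect matching of \<open>A\<close>: it tells \<open>A\<close> from
  \<open>B\<close>, so the other \<open>k\<close> matchings only have to deal with pairs inside \<open>A\<close> and pairs inside \<open>B\<close>,
  and can be chosen independently there (\<open>separating_matchings_Un\<close>). Inside \<open>B\<close> the induction
  hypothesis applies. Inside \<open>A\<close> an explicit system leaves room for a perfect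
  matching: for \<open>k \<ge> 2\<close>, identify \<open>A\<close> with the cube \<open>{0,1}\<^sup>k\<close>, and let matching \<open>i\<close> cover the vertices whose
  coordinate \<open>i\<close> is 1 (\<open>cube_matchings\<close>); for \<open>k = 1\<close> the perfect matching of the two vertices
  of \<open>A\<close> does everything (\<open>pair_matchings\<close>).

  The count \<open>2\<^sup>k + 1\<close> requires \<open>k \<ge> 1\<close>: for \<open>n = 2\<close> there are no matchings, and the single edge is
  satisfied by the color of the remaining edges.
\<close>

section \<open>Separating systems of matchings\<close>

text \<open>A matching on \<open>V\<close> is represented by the involution that exchanges the ends of each of its
  edges, so that the fixed points are the uncovered vertices. The second conjunct says that the
  matchings are edge-disjoint.\<close>

definition separating_matchings :: "'a set \<Rightarrow> nat \<Rightarrow> (nat \<Rightarrow> 'a \<Rightarrow> 'a) \<Rightarrow> bool" where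
  "separating_matchings V k m \<longleftrightarrow>
     (\<forall>i<k. \<forall>x\<in>V. m i x \<in> V \<and> m i (m i x) = x) \<and>
     (\<forall>i<k. \<forall>j<k. \<forall>x\<in>V. i \<noteq> j \<longrightarrow> m i x = m j x \<longrightarrow> m i x = x) \<and>
     (\<forall>x\<in>V. \<forall>y\<in>V. x \<noteq> y \<longrightarrow> (\<exists>i<k. m i x = y \<or> (m i x = x) \<noteq> (m i y = y)))"

lemma separating_matchingsD:
  assumes "separating_matchings V k m" and "x \<in> V"
  shows "i < k \<Longrightarrow> m i x \<in> V" and "i < k \<Longrightarrow> m i (m i x) = x"
    and "\<lbrakk>i < k; j < k; i \<noteq> j; m i x = m j x\<rbrakk> \<Longrightarrow> m i x = x"
    and "\<lbrakk>y \<in> V; x \<noteq> y\<rbrakk> \<Longrightarrow> \<exists>i<k. m i x = y \<or> (m i x = x) \<noteq> (m i y = y)"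
  using assms unfolding separating_matchings_def by blast+

lemma separating_matchings_bij:
  assumes m: "separating_matchings W k m" and g: "bij_betw g V W"
  shows "separating_matchings V k (\<lambda>i x. inv_into V g (m i (g x)))"
proof -
  define h where "h = inv_into V g"
  have gW: "g x \<in> W" and hg: "h (g x) = x" if "x \<in> V" for x
    using that g by (auto simp: h_def bij_betw_def)
  have hV: "h y \<in> V" and gh: "g (h y) = y" if "y \<in> W" for y
    using that g unfolding h_def
    by (auto simp: bij_betw_def inv_into_into f_inv_into_f)
  have h_eq: "h y = x \<longleftrightarrow> y = g x" if "y \<in> W" "x \<in> V" for x y
    using that gh hg by auto
  have mW: "m i (g x) \<in> W" "m i (m i (g x)) = g x" if "i < k" "x \<in> V" for i x
    using separating_matchingsD(1,2)[OF m] that gW by auto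
  have "h (m i (g x)) \<in> V \<and> h (m i (g (h (m i (g x))))) = x" if "i < k" "x \<in> V" for i x
    using that mW hV gh hg by simp
  moreover have "h (m i (g x)) = x"
    if "i < k" "j < k" "x \<in> V" "i \<noteq> j" "h (m i (g x)) = h (m j (g x))" for i j x
  proof -
    have "m i (g x) = m j (g x)" using that mW gh by metis
    then have "m i (g x) = g x"
      using separating_matchingsD(3)[OF m] that gW by blast
    then show ?thesis using hg that by simp
  qed
  moreover have "\<exists>i<k. h (m i (g x)) = y \<or> (h (m i (g x)) = x) \<noteq> (h (m i (g y)) = y)"
    if xy: "x \<in> V" "y \<in> V" "x \<noteq> y" for x y
  proof -
    have "g x \<noteq> g y" using xy hg by metis
    then obtain i where "i < k"
      "m i (g x) = g y \<or> (m i (g x) = g x) \<noteq> (m i (g y) = g y)"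
      using separating_matchingsD(4)[OF m] xy gW by blast
    then show ?thesis using xy mW h_eq by metis
  qed
  ultimately show ?thesis unfolding separating_matchings_def h_def by blast
qed

text \<open>Matching \<open>k\<close> covers all of \<open>A\<close> and nothing of \<open>B\<close>, so it deals with all pairs between \<open>A\<close>
  and \<open>B\<close>.\<close>

lemma separating_matchings_Un:
  assumes A: "separating_matchings A (Suc k) m" and perfect: "\<And>x. x \<in> A \<Longrightarrow> m k x \<noteq> x"
    and B: "separating_matchings B k m'" and disj: "A \<inter> B = {}"
  shows "separating_matchings (A \<union> B) (Suc k)
           (\<lambda>i x. if x \<in> A then m i x else if i < k then m' i x else x)"
proof -
  define p where "p = (\<lambda>i x. if x \<in> A then m i x else if i < k then m' i x else x)"
  have pA: "p i x = m i x" if "x \<in> A" for i x using that by (simp add: p_def)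
  have pB: "p i x = (if i < k then m' i x else x)" if "x \<in> B" for i x
    using that disj by (auto simp: p_def)
  have A_inv: "m i x \<in> A" "m i (m i x) = x" if "i < Suc k" "x \<in> A" for i x
    using separating_matchingsD(1,2)[OF A] that by auto
  have B_inv: "m' i x \<in> B" "m' i (m' i x) = x" if "i < k" "x \<in> B" for i x
    using separating_matchingsD(1,2)[OF B] that by auto
  have "p i x \<in> A \<union> B \<and> p i (p i x) = x" if "i < Suc k" "x \<in> A \<union> B" for i x
    using that A_inv B_inv by (cases "x \<in> A") (auto simp: pA pB)
  moreover have "p i x = x"
    if ij: "i < Suc k" "j < Suc k" "i \<noteq> j" and x: "x \<in> A \<union> B" and eq: "p i x = p j x" for i j x
  proof (cases "x \<in> A")
    case True
    then show ?thesis using separating_matchingsD(3)[OF A True ij] eq by (simp add: pA)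
  next
    case False
    then have "x \<in> B" using x by simp
    then show ?thesis using separating_matchingsD(3)[OF B, of x i j] ij eq
      by (auto simp: pB split: if_splits)
  qed
  moreover have "\<exists>i<Suc k. p i x = y \<or> (p i x = x) \<noteq> (p i y = y)"
    if "x \<in> A \<union> B" "y \<in> A \<union> B" "x \<noteq> y" for x y
  proof -
    consider "x \<in> A" "y \<in> A" | "x \<in> B" "y \<in> B" | "x \<in> A" "y \<in> B" | "x \<in> B" "y \<in> A"
      using \<open>x \<in> A \<union> B\<close> \<open>y \<in> A \<union> B\<close> by blast
    then show ?thesis
    proof cases
      case 1
      then show ?thesis using separating_matchingsD(4)[OF A] \<open>x \<noteq> y\<close> by (simp add: pA)
    next
      case 2
      then obtain i where "i < k" "m' i x = y \<or> (m' i x = x) \<noteq> (m' i y = y)"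
        using separating_matchingsD(4)[OF B] \<open>x \<noteq> y\<close> by blast
      then show ?thesis using 2 by (intro exI[of _ i]) (simp add: pB)
    next
      case 3
      then show ?thesis using perfect by (intro exI[of _ k]) (simp add: pA pB)
    next
      case 4
      then show ?thesis using perfect by (intro exI[of _ k]) (simp add: pA pB)
    qed
  qed
  ultimately have "separating_matchings (A \<union> B) (Suc k) p"
    unfolding separating_matchings_def by blast
  then show ?thesis unfolding p_def .
qed

section \<open>Systems containing a perfect matching\<close>

text \<open>On two vertices the perfect matching alone suffices. This starts the induction, and it
  replaces the one-dimensional cube, which is too small to have distinct directions for all the
  matchings.\<close>

lemma pair_matchings:
  assumes "card A = 2"
  shows "\<exists>m. separating_matchings A (Suc k) m \<and> (\<forall>x\<in>A. m k x \<noteq> x)"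
proof -
  obtain a b where ab: "A = {a, b}" "a \<noteq> b" using assms by (auto simp: card_2_iff)
  define m where "m = (\<lambda>i x. if i < k then x else if x = a then b else a)"
  have "separating_matchings A (Suc k) m"
    using ab unfolding separating_matchings_def m_def by (auto simp: less_Suc_eq)
  moreover have "\<forall>x\<in>A. m k x \<noteq> x" using ab by (simp add: m_def)
  ultimately show ?thesis by blast
qed

text \<open>The vertices of the \<open>k\<close>-dimensional cube are encoded as the numbers below \<open>2\<^sup>k\<close>. Matching
  \<open>i < k\<close> covers the vertices with bit \<open>i\<close> set, and any two vertices differ in some bit. It
  moves each of them along a direction that leaves bit \<open>i\<close> alone, namely along coordinate
  \<open>i + 1\<close> (cyclically). Different matchings use different directions, hence are edge-disjoint. The
  direction \<open>3\<close>, which changes two coordinates, remains free for a perfect matching.\<close>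

lemma cube_matchings:
  fixes k :: nat
  assumes k: "2 \<le> k"
  shows "\<exists>m. separating_matchings {..<2 ^ k :: nat} (Suc k) m \<and> (\<forall>x. m k x \<noteq> x)"
proof -
  define m where "m = (\<lambda>i (x::nat).
    if i < k then (if bit x i then xor x (2 ^ (Suc i mod k)) else x) else xor x 3)"
  have xor_cancel: "xor x a = xor x b \<longleftrightarrow> a = b" for x a b :: nat
    by (metis xor.left_neutral xor.assoc xor_self_eq)
  have xor_fixed: "xor x a = x \<longleftrightarrow> a = 0" for x a :: nat
    using xor_cancel[of x a 0] by simp
  have xor_less: "xor x a < 2 ^ k" if "x < 2 ^ k" "a < 2 ^ k" for x a :: nat
    using that by (metis take_bit_nat_eq_self_iff take_bit_xor)
  have three: "(3::nat) < 2 ^ k"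
    using power_increasing[OF k, of "2::nat"] by simp
  have dir_less: "(2::nat) ^ (Suc i mod k) < 2 ^ k" for i
    using k by (intro power_strict_increasing) auto
  have three_not_power: "(2::nat) ^ j \<noteq> 3" for j
  proof (cases j)
    case (Suc l)
    then have "even ((2::nat) ^ j)" by simp
    then show ?thesis by (metis odd_numeral)
  qed simp
  have next_neq: "Suc i mod k \<noteq> i" if "i < k" for i
    using that k by (auto simp: mod_Suc)
  have next_inj: "i = j" if "i < k" "j < k" "Suc i mod k = Suc j mod k" for i j
    using that by (auto simp: mod_Suc split: if_splits)
  have bit_move: "bit (xor x (2 ^ (Suc i mod k))) i = bit x i" if "i < k" for x i :: nat
    using next_neq[OF that] by (simp add: bit_xor_iff bit_exp_iff)
  have m_fixed: "m i x = x \<longleftrightarrow> i < k \<and> \<not> bit x i" for i x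
    by (simp add: m_def xor_fixed)
  have "m i x \<in> {..<2 ^ k} \<and> m i (m i x) = x" if "i < Suc k" "x \<in> {..<2 ^ k}" for i x
    using that xor_less dir_less three by (auto simp: m_def bit_move xor.assoc)
  moreover have "m i x = x"
    if "i < Suc k" "j < Suc k" "i \<noteq> j" "m i x = m j x" for i j x
  proof (rule ccontr)
    assume moved: "m i x \<noteq> x"
    then have "m j x \<noteq> x" using that by simp
    define dir where "dir l = (if l < k then 2 ^ (Suc l mod k) else 3 :: nat)" for l
    have "m i x = xor x (dir i)" "m j x = xor x (dir j)"
      using moved \<open>m j x \<noteq> x\<close> by (auto simp: m_def dir_def split: if_splits)
    then have "dir i = dir j" using that by (simp add: xor_cancel)
    then show False using next_inj[of i j] three_not_power \<open>i < Suc k\<close> \<open>j < Suc k\<close> \<open>i \<noteq> j\<close>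
      by (auto simp: dir_def less_Suc_eq split: if_splits)
  qed
  moreover have "\<exists>i<Suc k. m i x = y \<or> (m i x = x) \<noteq> (m i y = y)"
    if "x \<in> {..<2 ^ k}" "y \<in> {..<2 ^ k}" "x \<noteq> y" for x y
  proof -
    obtain i where i: "bit x i \<noteq> bit y i" using \<open>x \<noteq> y\<close> bit_eq_iff by blast
    have "i < k"
    proof (rule ccontr)
      assume "\<not> i < k"
      moreover have "take_bit k x = x" "take_bit k y = y"
        using that by (auto simp: take_bit_nat_eq_self_iff)
      ultimately have "\<not> bit x i" "\<not> bit y i" by (metis bit_take_bit_iff)+
      then show False using i by simp
    qed
    then show ?thesis using i by (intro exI[of _ i]) (auto simp: m_fixed)
  qed
  ultimately have "separating_matchings {..<2 ^ k} (Suc k) m"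
    unfolding separating_matchings_def by blast
  moreover have "m k x \<noteq> x" for x by (simp add: m_fixed)
  ultimately show ?thesis by blast
qed

lemma perfect_separating_matchings_exist:
  fixes A :: "'a set"
  assumes k: "1 \<le> k" and card: "card A = 2 ^ k"
  shows "\<exists>m. separating_matchings A (Suc k) m \<and> (\<forall>x\<in>A. m k x \<noteq> x)"
proof (cases "k = 1")
  case True
  then have "card A = 2" using card by simp
  then show ?thesis by (rule pair_matchings)
next
  case False
  then have k2: "2 \<le> k" using k by simp
  have "card A > 0" using card by simp
  then have "finite A" using card_gt_0_iff by blast
  then obtain g where g: "bij_betw g A {..<2 ^ k :: nat}"
    using card by (metis ex_bij_betw_finite_nat atLeast0LessThan)
  obtain m :: "nat \<Rightarrow> nat \<Rightarrow> nat" where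
    m: "separating_matchings {..<2 ^ k} (Suc k) m" and perfect: "\<And>x. m k x \<noteq> x"
    using cube_matchings[OF k2] by metis
  have "inv_into A g (m k (g x)) \<noteq> x" if "x \<in> A" for x
  proof -
    have "m k (g x) \<in> g ` A"
      using separating_matchingsD(1)[OF m, of "g x" k] g that unfolding bij_betw_def by blast
    then show ?thesis using perfect by (metis f_inv_into_f)
  qed
  then show ?thesis using separating_matchings_bij[OF m g] by blast
qed

section \<open>Systems on up to \<open>2\<^sup>k + 1\<close> vertices\<close>

text \<open>The exponential bound starts at \<open>k = 1\<close>: two vertices need a matching, so for \<open>k = 0\<close> only
  one vertex is possible.\<close>

lemma separating_matchings_exist:
  fixes V :: "'a set"
  assumes "1 \<le> k" and "finite V" and "card V \<le> 2 ^ k + 1"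
  shows "\<exists>m. separating_matchings V k m"
  using assms
proof (induction k arbitrary: V rule: nat_induct_at_least)
  case base
  show ?case
  proof (cases "card V \<le> 1")
    case True
    then have "x = y" if "x \<in> V" "y \<in> V" for x y
      using that base by (metis One_nat_def card_le_Suc0_iff_eq)
    then have "separating_matchings V 1 (\<lambda>i x. x)" unfolding separating_matchings_def by auto
    then show ?thesis by blast
  next
    case False
    then have "2 \<le> card V" by simp
    then obtain A where A: "A \<subseteq> V" "card A = 2" by (metis obtain_subset_with_card_n)
    then obtain m where m: "separating_matchings A (Suc 0) m" "\<And>x. x \<in> A \<Longrightarrow> m 0 x \<noteq> x"
      using pair_matchings by metis
    have "card (V - A) \<le> 1" using A base by (simp add: card_Diff_subset finite_subset)
    then have "x = y" if "x \<in> V - A" "y \<in> V - A" for x y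
      using that base by (metis One_nat_def card_le_Suc0_iff_eq finite_Diff)
    then have "separating_matchings (V - A) 0 (\<lambda>i x. x)"
      unfolding separating_matchings_def by auto
    from separating_matchings_Un[OF m this]
    have "\<exists>m. separating_matchings (A \<union> (V - A)) (Suc 0) m" by blast
    moreover have "A \<union> (V - A) = V" using A by blast
    ultimately show ?thesis by simp
  qed
next
  case (Suc k)
  \<comment> \<open>With \<open>A\<close> empty, the new matching is empty; this covers every \<open>V\<close> that \<open>k\<close> matchings can handle.\<close>
  obtain A where A: "A \<subseteq> V" "card (V - A) \<le> 2 ^ k + 1" "A = {} \<or> card A = 2 ^ k"
  proof (cases "card V \<le> 2 ^ k + 1")
    case True
    then show ?thesis using that[of "{}"] by simp
  next
    case False
    then have "2 ^ k \<le> card V" by simp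
    then obtain A where A: "A \<subseteq> V" "card A = 2 ^ k" by (metis obtain_subset_with_card_n)
    then have "card (V - A) = card V - 2 ^ k"
      using Suc.prems by (simp add: card_Diff_subset finite_subset)
    then show ?thesis using that[of A] A Suc.prems by simp
  qed
  obtain m where m: "separating_matchings A (Suc k) m" "\<And>x. x \<in> A \<Longrightarrow> m k x \<noteq> x"
  proof (cases "A = {}")
    case True
    then show ?thesis using that by (simp add: separating_matchings_def)
  next
    case False
    then have "card A = 2 ^ k" using A by blast
    then show ?thesis using that perfect_separating_matchings_exist[OF Suc.hyps] by metis
  qed
  obtain m' where "separating_matchings (V - A) k m'"
    using Suc.IH A Suc.prems by blast
  from separating_matchings_Un[OF m this]
  have "\<exists>p. separating_matchings (A \<union> (V - A)) (Suc k) p" by blast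
  moreover have "A \<union> (V - A) = V" using A by blast
  ultimately show ?case by simp
qed

section \<open>Conflict-free colorings of complete graphs\<close>

text \<open>The matching edges \<open>{x, m i x}\<close> receive color \<open>i\<close>. Matchings are edge-disjoint, so the least
  such \<open>i\<close> is the only one. Including \<open>k\<close> among the candidates gives color \<open>k\<close> to the edges outside
  all matchings.\<close>

lemma conflict_free_complete_graph_if_separating_matchings:
  assumes m: "separating_matchings {..<n} k m"
  shows "\<exists>c :: nat set \<Rightarrow> nat. conflict_free (complete_graph n) c \<and> range c \<subseteq> {..k}"
proof -
  define V where "V = {..<n}"
  have m': "separating_matchings V k m" using m unfolding V_def .
  define c where "c e = (LEAST i. i = k \<or> (\<exists>x\<in>e. e = {x, m i x}))" for e
  have inv: "m i x \<in> V" "m i (m i x) = x" if "i < k" "x \<in> V" for i x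
    using separating_matchingsD(1,2)[OF m'] that by auto
  have c_le: "c e \<le> k" for e unfolding c_def by (rule Least_le) simp
  have matched_if_c: "m i x = y" if "c {x, y} = i" "i < k" "x \<in> V" "y \<in> V" "x \<noteq> y" for x y i
  proof -
    have "i = k \<or> (\<exists>z\<in>{x, y}. {x, y} = {z, m i z})"
      unfolding that(1)[symmetric] c_def by (rule LeastI[of _ k]) simp
    then have "m i x = y \<or> m i y = x"
      using that by (auto simp: doubleton_eq_iff)
    then show ?thesis using inv(2)[OF \<open>i < k\<close> \<open>y \<in> V\<close>] by auto
  qed
  have c_iff: "c {x, y} = i \<longleftrightarrow> m i x = y" if "i < k" "x \<in> V" "y \<in> V" "x \<noteq> y" for x y i
  proof
    assume eq: "m i x = y"
    have "c {x, y} \<le> i" unfolding c_def using eq by (intro Least_le) auto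
    then have "c {x, y} < k" using \<open>i < k\<close> by simp
    moreover from this have "m (c {x, y}) x = y" using matched_if_c that by blast
    ultimately show "c {x, y} = i"
      using separating_matchingsD(3)[OF m' \<open>x \<in> V\<close>] that eq by metis
  qed (use matched_if_c that in blast)
  \<comment> \<open>At each vertex, color \<open>i\<close> occurs exactly on its edge in matching \<open>i\<close>, if there is one.\<close>
  have at_vertex: "f \<in> incident_edges (complete_graph n) u \<and> c f = i \<longleftrightarrow>
      m i u \<noteq> u \<and> f = {u, m i u}" if "i < k" "u \<in> V" for i u f
  proof
    assume f: "f \<in> incident_edges (complete_graph n) u \<and> c f = i"
    then have "card f = 2" "u \<in> f" "f \<subseteq> V"
      by (auto simp: incident_edges_def complete_graph_def V_def)
    then obtain w where "f = {u, w}" "u \<noteq> w" "w \<in> V" by (auto simp: card_2_iff)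
    then show "m i u \<noteq> u \<and> f = {u, m i u}" using c_iff that f by auto
  next
    assume f: "m i u \<noteq> u \<and> f = {u, m i u}"
    then have "c f = i" using c_iff[of i u "m i u"] inv that by auto
    moreover have "card f = 2" using f by (metis card_2_iff)
    ultimately show "f \<in> incident_edges (complete_graph n) u \<and> c f = i"
      using f inv that by (auto simp: incident_edges_def complete_graph_def V_def)
  qed
  have "edge_satisfied (complete_graph n) c e" if "e \<in> edges (complete_graph n)" for e
  proof -
    have "card e = 2" "e \<subseteq> V" using that by (auto simp: complete_graph_def V_def)
    then obtain x y where e: "e = {x, y}" "x \<noteq> y" "x \<in> V" "y \<in> V" by (auto simp: card_2_iff)
    then obtain i where i: "i < k" and sep: "m i x = y \<or> (m i x = x) \<noteq> (m i y = y)"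
      using separating_matchingsD(4)[OF m'] by blast
    have nbhd: "f \<in> closed_edge_nbhd (complete_graph n) e \<and> c f = i \<longleftrightarrow>
        (m i x \<noteq> x \<and> f = {x, m i x}) \<or> (m i y \<noteq> y \<and> f = {y, m i y})" for f
      using at_vertex[OF i e(3), of f] at_vertex[OF i e(4), of f]
      unfolding e(1) closed_edge_nbhd_pair by blast
    have "\<exists>!f. f \<in> closed_edge_nbhd (complete_graph n) e \<and> c f = i"
    proof (cases "m i x = y")
      case True
      then have "m i y = x" using inv i e by auto
      then show ?thesis using True e(2) unfolding nbhd by (auto simp: insert_commute)
    next
      case False
      then show ?thesis using sep unfolding nbhd by blast
    qed
    then show ?thesis unfolding edge_satisfied_def by blast
  qed
  then show ?thesis using c_le unfolding conflict_free_def by blast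
qed

lemma cf_chromatic_index_le:
  fixes c :: "'a set \<Rightarrow> nat"
  assumes "conflict_free G c" and "range c \<subseteq> {..k}"
  shows "cf_chromatic_index G \<le> k + 1"
proof -
  have "cf_chromatic_index G \<le> card (c ` edges G)"
    unfolding cf_chromatic_index_def using assms(1) by (intro Least_le) blast
  also have "\<dots> \<le> card {..k}" using assms(2) by (intro card_mono) auto
  finally show ?thesis by simp
qed

lemma conflict_free_complete_graph_2: "conflict_free (complete_graph 2) (\<lambda>e. 0 :: nat)"
proof -
  have "e \<subseteq> {0, 1} \<and> card e = 2 \<longleftrightarrow> e = {0, 1}" for e :: "nat set"
  proof
    assume "e \<subseteq> {0, 1} \<and> card e = 2"
    then show "e = {0, 1}" by (intro card_subset_eq) simp_all
  qed simp
  moreover have "{..<2} = {0, 1 :: nat}" by auto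
  ultimately have "edges (complete_graph 2) = {{0, 1}}"
    unfolding complete_graph_def by (simp only: snd_conv singleton_conv)
  then show ?thesis
    by (auto simp: conflict_free_def edge_satisfied_def closed_edge_nbhd_def incident_edges_def)
qed

theorem theorem8:
  fixes n :: nat
  assumes "n \<ge> 2"
  shows "int (cf_chromatic_index (complete_graph n)) \<le> \<lceil>log 2 (real n - 1)\<rceil> + 1"
proof (cases "n = 2")
  case True
  have "cf_chromatic_index (complete_graph 2) \<le> 0 + 1"
    by (rule cf_chromatic_index_le[OF conflict_free_complete_graph_2]) auto
  then show ?thesis using True by simp
next
  case False
  define k where "k = nat \<lceil>log 2 (real n - 1)\<rceil>"
  have n: "real n - 1 \<ge> 2" using assms False by linarith
  then have "log 2 (real n - 1) \<ge> 1" by simp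
  then have k: "int k = \<lceil>log 2 (real n - 1)\<rceil>" "1 \<le> k" unfolding k_def by linarith+
  have "log 2 (real n - 1) \<le> real k" using k(1) by linarith
  then have "real n - 1 \<le> 2 powr real k" using n by (simp add: log_le_iff)
  then have "real n \<le> real (2 ^ k + 1)" by (simp add: powr_realpow)
  then have "n \<le> 2 ^ k + 1" by (simp only: of_nat_le_iff)
  then obtain m :: "nat \<Rightarrow> nat \<Rightarrow> nat" where "separating_matchings {..<n} k m"
    using separating_matchings_exist[OF k(2), of "{..<n}"] by auto
  then obtain c :: "nat set \<Rightarrow> nat" where "conflict_free (complete_graph n) c" "range c \<subseteq> {..k}"
    using conflict_free_complete_graph_if_separating_matchings by blast
  then have "cf_chromatic_index (complete_graph n) \<le> k + 1" by (rule cf_chromatic_index_le)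
  then show ?thesis using k(1) by linarith
qed

end
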